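(* For the symmetric body with rotor ($I_1=I_2$, $\gamma>0$), to perform a dive with $m$ somersaults and $n$ twists in a total time $T_{tot}=2T_2+T_3+2T_1$ the equation \[ \frac{l}{I_1}T_{tot}-2m\pi=2\frac{l}{I_1}T_2-2\phi_2 \] needs to be satisfied, where the right hand side depends on the maximal tilt $s=\sin\theta_{max}$ only. In addition, the condition that $T_1$ is non-negative, \[ 2\frac{l}{I_1}T_1=2\pi m-2\phi_2-\frac{2\pi(n-\frac12)}{\gamma\sin\theta_{max}}\ge0, \] needs to be satisfied.
   Context: Symmetric body with rotor: $I_1=I_2$, $\gamma=I_1/I_3-1>0$, where $I_i$ are the principal moments of inertia and $l>0$ is the magnitude of the total angular momentum. With rotor parameter $r$ (equal to $h/l$ for internal angular momentum $(0,h,0)^t$ when the rotor is on, and $0$ when it is off) the equations of motion in dimensionless time $\tau=tl/I_1$ are $\phi'=1+r\sec\theta\sin\psi$, $\theta'=-r\cos\psi$, $\psi'=\gamma\sin\theta-r\tan\theta\sin\psi$; $\phi,\theta,\psi$ are the somersault, tilt and twist angles, and the body-frame angular momentum is $\mathbf{L}=l(\cos\theta\cos\psi,-\cos\theta\sin\psi,\sin\theta)$. A dive consists of five consecutive stages, with continuous angles: Stage 1 (rotor off, duration $T_1$): pure somersault, $\theta=\psi=0$. Stage 2 (rotor on, duration $T_2$): $r=-\rho$ with a constant $\rho>0$ (the sign for which $\theta$ increases from $0$), started at $\theta=\psi=0$ and run until $\theta$ first reaches the maximal value $\theta_{max}\in(0,\pi/2)$ along the orbit; this happens at $\psi=\pi/2$.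 Stage 3 (rotor off, duration $T_3$): $\theta=\theta_{max}$ is constant. Stage 4 (rotor on, duration $T_2$): $r=+\rho$ if $n$ is an integer, $r=-\rho$ if $n$ is a half-integer; it brings the body back to $\theta=0$, $\psi\in\pi\mathbb{Z}$, and is a mirror image of stage 2, contributing the same somersault and twist as stage 2. Stage 5 (rotor off, duration $T_1$): pure somersault. $\phi_i,\psi_i$ are the advances of $\phi,\psi$ in stage $i$; in particular $\psi_2=\psi_4=\pi/2$ and $\phi_2=\phi_4$. The dive has $m$ somersaults and $n$ twists if $2\phi_1+2\phi_2+\phi_3=2m\pi$ and $2\psi_1+2\psi_2+\psi_3=2n\pi$, where $n\ge\frac12$ is an integer or half-integer. *)

theory Defs
  imports Complex_Main
begin

text \<open>
  All angles are functions of the dimensionless time \<open>\<tau> = t l / I\<^sub>1\<close>. Since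
  \<open>\<phi>\<close> and \<open>\<psi>\<close> are real-valued rather than reduced modulo \<open>2\<pi>\<close>,
  their increments count revolutions.

  The equations of motion are required on a set \<open>S\<close> of times, with derivatives taken within
  \<open>S\<close>, so they are one-sided at the end points of an interval. The condition
  \<open>cos \<theta> \<noteq> 0\<close> keeps the motion away from the singularity of \<open>sec \<theta>\<close> and
  \<open>tan \<theta>\<close>, which would otherwise silently take the value \<open>0\<close>.
\<close>

definition rotor_motion ::
  "real \<Rightarrow> real \<Rightarrow> (real \<Rightarrow> real) \<Rightarrow> (real \<Rightarrow> real) \<Rightarrow> (real \<Rightarrow> real) \<Rightarrow> real set \<Rightarrow> bool" where
  "rotor_motion \<gamma> r \<phi> \<theta> \<psi> S \<longleftrightarrow> (\<forall>\<tau>\<in>S. cos (\<theta> \<tau>) \<noteq> 0 \<and>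
     (\<phi> has_real_derivative 1 + r * (1 / cos (\<theta> \<tau>)) * sin (\<psi> \<tau>)) (at \<tau> within S) \<and>
     (\<theta> has_real_derivative - r * cos (\<psi> \<tau>)) (at \<tau> within S) \<and>
     (\<psi> has_real_derivative \<gamma> * sin (\<theta> \<tau>) - r * tan (\<theta> \<tau>) * sin (\<psi> \<tau>)) (at \<tau> within S))"

text \<open>
  The five stages have (dimensionless) durations \<open>\<tau>\<^sub>1, \<tau>\<^sub>2, \<tau>\<^sub>3, \<tau>\<^sub>2, \<tau>\<^sub>1\<close>
  and are numbered from \<open>1\<close>; \<open>stage_end \<dots> 0 = 0\<close> is the start of the dive.
\<close>

definition stage_end :: "real \<Rightarrow> real \<Rightarrow> real \<Rightarrow> nat \<Rightarrow> real" where
  "stage_end \<tau>\<^sub>1 \<tau>\<^sub>2 \<tau>\<^sub>3 i = sum_list (take i [\<tau>\<^sub>1, \<tau>\<^sub>2, \<tau>\<^sub>3, \<tau>\<^sub>2, \<tau>\<^sub>1])"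

definition stage :: "real \<Rightarrow> real \<Rightarrow> real \<Rightarrow> nat \<Rightarrow> real set" where
  "stage \<tau>\<^sub>1 \<tau>\<^sub>2 \<tau>\<^sub>3 i = {stage_end \<tau>\<^sub>1 \<tau>\<^sub>2 \<tau>\<^sub>3 (i - 1)..stage_end \<tau>\<^sub>1 \<tau>\<^sub>2 \<tau>\<^sub>3 i}"

definition advance :: "real \<Rightarrow> real \<Rightarrow> real \<Rightarrow> (real \<Rightarrow> real) \<Rightarrow> nat \<Rightarrow> real" where
  "advance \<tau>\<^sub>1 \<tau>\<^sub>2 \<tau>\<^sub>3 f i =
     f (stage_end \<tau>\<^sub>1 \<tau>\<^sub>2 \<tau>\<^sub>3 i) - f (stage_end \<tau>\<^sub>1 \<tau>\<^sub>2 \<tau>\<^sub>3 (i - 1))"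

definition first_reaches_max :: "(real \<Rightarrow> real) \<Rightarrow> real \<Rightarrow> real \<Rightarrow> real \<Rightarrow> bool" where
  "first_reaches_max f a b M \<longleftrightarrow>
     a \<le> b \<and> f b = M \<and> (\<forall>\<tau>\<ge>a. f \<tau> \<le> M) \<and> (\<forall>\<tau>. a \<le> \<tau> \<and> \<tau> < b \<longrightarrow> f \<tau> < M)"

text \<open>
  Neighbouring stages share their common end point, so the angles are continuous throughout.
  In stage 2, \<open>\<theta>\<^sub>m\<^sub>a\<^sub>x\<close> is the maximal tilt along the whole orbit that would result
  if the rotor were never switched off; this orbit is \<open>(\<Phi>, \<Theta>, \<Psi>)\<close>. That the twist
  equals \<open>\<pi>/2\<close> when the maximum is reached, and that stage 4 contributes the same
  somersault and twist as stage 2, are consequences and are not assumed.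
\<close>

definition dive ::
  "real \<Rightarrow> real \<Rightarrow> real \<Rightarrow> real \<Rightarrow> real \<Rightarrow> real \<Rightarrow> real \<Rightarrow>
   (real \<Rightarrow> real) \<Rightarrow> (real \<Rightarrow> real) \<Rightarrow> (real \<Rightarrow> real) \<Rightarrow> bool" where
  "dive \<gamma> \<rho> n \<theta>\<^sub>m\<^sub>a\<^sub>x \<tau>\<^sub>1 \<tau>\<^sub>2 \<tau>\<^sub>3 \<phi> \<theta> \<psi> \<longleftrightarrow>
     (let S = stage \<tau>\<^sub>1 \<tau>\<^sub>2 \<tau>\<^sub>3; e = stage_end \<tau>\<^sub>1 \<tau>\<^sub>2 \<tau>\<^sub>3 in
      0 \<le> \<tau>\<^sub>1 \<and> 0 \<le> \<tau>\<^sub>2 \<and> 0 \<le> \<tau>\<^sub>3 \<and>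
      rotor_motion \<gamma> 0 \<phi> \<theta> \<psi> (S 1) \<and> (\<forall>\<tau>\<in>S 1. \<theta> \<tau> = 0 \<and> \<psi> \<tau> = 0) \<and>
      rotor_motion \<gamma> (- \<rho>) \<phi> \<theta> \<psi> (S 2) \<and>
      (\<exists>\<Phi> \<Theta> \<Psi>. rotor_motion \<gamma> (- \<rho>) \<Phi> \<Theta> \<Psi> {e 1..} \<and>
         (\<forall>\<tau>\<in>S 2. \<Phi> \<tau> = \<phi> \<tau> \<and> \<Theta> \<tau> = \<theta> \<tau> \<and> \<Psi> \<tau> = \<psi> \<tau>) \<and>
         first_reaches_max \<Theta> (e 1) (e 2) \<theta>\<^sub>m\<^sub>a\<^sub>x) \<and>
      rotor_motion \<gamma> 0 \<phi> \<theta> \<psi> (S 3) \<and> (\<forall>\<tau>\<in>S 3. \<theta> \<tau> = \<theta>\<^sub>m\<^sub>a\<^sub>x) \<and>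
      rotor_motion \<gamma> (if n \<in> \<int> then \<rho> else - \<rho>) \<phi> \<theta> \<psi> (S 4) \<and>
      \<theta> (e 4) = 0 \<and> (\<exists>k::int. \<psi> (e 4) = of_int k * pi) \<and>
      rotor_motion \<gamma> 0 \<phi> \<theta> \<psi> (S 5) \<and> (\<forall>\<tau>\<in>S 5. \<theta> \<tau> = 0 \<and> \<psi> \<tau> = \<psi> (e 4)))"

definition somersaults_twists ::
  "real \<Rightarrow> real \<Rightarrow> real \<Rightarrow> real \<Rightarrow> real \<Rightarrow> (real \<Rightarrow> real) \<Rightarrow> (real \<Rightarrow> real) \<Rightarrow> bool" where
  "somersaults_twists m n \<tau>\<^sub>1 \<tau>\<^sub>2 \<tau>\<^sub>3 \<phi> \<psi> \<longleftrightarrow>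
     (let \<Delta> = advance \<tau>\<^sub>1 \<tau>\<^sub>2 \<tau>\<^sub>3 in
      2 * \<Delta> \<phi> 1 + 2 * \<Delta> \<phi> 2 + \<Delta> \<phi> 3 = 2 * m * pi \<and>
      2 * \<Delta> \<psi> 1 + 2 * \<Delta> \<psi> 2 + \<Delta> \<psi> 3 = 2 * n * pi)"

end

theory Submission
  imports Defs "HOL-Analysis.Derivative"
begin

text \<open>
  All terms but one come from bookkeeping: with the rotor off, somersault advances like time and, at
  tilt \<open>\<theta>\<^sub>m\<^sub>a\<^sub>x\<close>, twist advances at the rate \<open>\<gamma> sin \<theta>\<^sub>m\<^sub>a\<^sub>x\<close>, so counting twists determines the
  duration of stage 3 and counting somersaults that of stage 1 (lemma \<open>dive_advances\<close>). This needs
  that stage 2 contributes exactly a quarter twist, and the first equation carries content only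
  because the lag of somersault behind time during stage 2 depends on \<open>\<theta>\<^sub>m\<^sub>a\<^sub>x\<close> alone, neither on
  \<open>\<gamma>\<close> nor on the rotor strength \<open>\<rho>\<close>.

  Both facts rest on the integral \<open>cos \<theta> sin \<psi> = (c/2) sin\<^sup>2 \<theta>\<close> with \<open>c = \<gamma>/\<rho>\<close> (lemma \<open>energy\<close>).
  It keeps \<open>sin \<psi>\<close> nonnegative, so the twist stays in \<open>[0, \<pi>]\<close> and must be \<open>\<pi>/2\<close> where
  \<open>\<theta>' = \<rho> cos \<psi>\<close> vanishes. Evaluated there it reads \<open>cos \<theta>\<^sub>m\<^sub>a\<^sub>x = (c/2) sin\<^sup>2 \<theta>\<^sub>m\<^sub>a\<^sub>x\<close>, so the
  maximal tilt determines \<open>c\<close>. In units of \<open>1/\<rho>\<close> the tilt and twist equations contain no other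
  parameter, and uniqueness of their solution determines the tilt curve and the duration of the
  stage in these units; the lag is the integral of \<open>(c/2) tan\<^sup>2 \<theta>\<close>. The lag could also be written
  as an elliptic integral over \<open>\<theta>\<close>, but that integral is improper at \<open>\<theta>\<^sub>m\<^sub>a\<^sub>x\<close>; uniqueness avoids
  it and takes only a Gronwall estimate for a Duffing oscillator.
\<close>

section \<open>Integration on a half-line\<close>

lemma has_real_derivative_at_Ici:
  fixes f :: "real \<Rightarrow> real"
  assumes "(f has_real_derivative d) (at t within {a..})" "a < t"
  shows "(f has_real_derivative d) (at t)"
  using assms at_within_open_subset[of t "{a<..}" "{a..}"] by (simp add: Ioi_le_Ico)

lemma eq_if_equal_derivs_Ici:
  fixes f g :: "real \<Rightarrow> real"
  assumes f: "\<And>t. a \<le> t \<Longrightarrow> (f has_real_derivative d t) (at t within {a..})"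
    and g: "\<And>t. a \<le> t \<Longrightarrow> (g has_real_derivative d t) (at t within {a..})"
    and "a \<le> t"
  shows "f t - f a = g t - g a"
proof -
  have "((\<lambda>t. f t - g t) has_real_derivative 0) (at t within {a..})" if "a \<le> t" for t
    using DERIV_diff[OF f[OF that] g[OF that]] by simp
  then obtain k where "\<And>t. t \<in> {a..} \<Longrightarrow> f t - g t = k"
    using has_field_derivative_zero_constant[of "{a..}" "\<lambda>t. f t - g t"] by auto
  from this[of t] this[of a] show ?thesis
    using \<open>a \<le> t\<close> by simp
qed

lemma gronwall_zero:
  fixes f :: "real \<Rightarrow> real"
  assumes deriv: "\<And>t. a \<le> t \<Longrightarrow> (f has_real_derivative d t) (at t within {a..})"
    and growth: "\<And>t. a \<le> t \<Longrightarrow> d t \<le> C * f t"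
    and nonneg: "\<And>t. a \<le> t \<Longrightarrow> 0 \<le> f t"
    and start: "f a = 0" and t: "a \<le> t"
  shows "f t = 0"
proof -
  define h where "h = (\<lambda>t. f t * exp (- C * t))"
  have h: "(h has_real_derivative (d u - C * f u) * exp (- C * u)) (at u within {a..})"
    if "a \<le> u" for u
    unfolding h_def
    by (rule derivative_eq_intros deriv[OF that] refl | simp add: algebra_simps)+
  have "h t \<le> h a"
  proof (rule DERIV_nonpos_imp_decreasing_open[OF t])
    fix u assume "a < u" "u < t"
    then show "\<exists>y. (h has_real_derivative y) (at u) \<and> y \<le> 0"
      using has_real_derivative_at_Ici[OF h[of u]] growth[of u]
      by (intro exI[of _ "(d u - C * f u) * exp (- C * u)"]) (simp add: mult_le_0_iff)
  next
    have "continuous_on {a..} h"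
      using h DERIV_continuous_on[of "{a..}" h] by force
    then show "continuous_on {a..t} h"
      by (rule continuous_on_subset) auto
  qed
  then have "f t \<le> 0"
    using start by (simp add: h_def mult_le_0_iff)
  with nonneg[OF t] show ?thesis by simp
qed

section \<open>Orbits starting in pure somersault\<close>

text \<open>
  The quotient of twist frequency and rotor strength is the only parameter of the tilt and twist
  equations once time is measured in units of \<open>1/\<rho>\<close>. The somersault angle then runs behind time by
  the same amount as in the original motion, because both lags are the integral of
  \<open>\<rho> sin \<psi> / cos \<theta>\<close> over the original time.
\<close>

lemma rotor_motion_rescale:
  assumes motion: "rotor_motion \<gamma> (- \<rho>) \<Phi> \<Theta> \<Psi> {a..}" and "0 < \<rho>"
  shows "rotor_motion (\<gamma> / \<rho>) (- 1) (\<lambda>s. s - ((a + s / \<rho>) - \<Phi> (a + s / \<rho>)))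
           (\<lambda>s. \<Theta> (a + s / \<rho>)) (\<lambda>s. \<Psi> (a + s / \<rho>)) {0..}"
proof -
  have chain: "((\<lambda>s. f (a + s / \<rho>)) has_real_derivative d / \<rho>) (at s within {0..})"
    if "0 \<le> s" "(f has_real_derivative d) (at (a + s / \<rho>) within {a..})" for f d s
  proof -
    have "((\<lambda>s. a + s / \<rho>) has_real_derivative 1 / \<rho>) (at s within {0..})"
      using \<open>0 < \<rho>\<close> by (auto intro!: derivative_eq_intros)
    moreover have "(\<lambda>s. a + s / \<rho>) ` {0..} \<subseteq> {a..}"
      using \<open>0 < \<rho>\<close> by auto
    ultimately show ?thesis
      using DERIV_image_chain[of f d "\<lambda>s. a + s / \<rho>" s "{0..}" "1 / \<rho>"]
        DERIV_subset[OF that(2)] by (simp add: o_def)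
  qed
  show ?thesis
    unfolding rotor_motion_def
  proof (intro ballI conjI)
    fix s :: real assume "s \<in> {0..}"
    then have s: "0 \<le> s" by simp
    let ?t = "a + s / \<rho>"
    have "?t \<in> {a..}" using s \<open>0 < \<rho>\<close> by simp
    note m = bspec[OF motion[unfolded rotor_motion_def] this]
    show "cos (\<Theta> ?t) \<noteq> 0" using m by simp
    have eq: "1 - (1 - (1 + - \<rho> * (1 / cos (\<Theta> ?t)) * sin (\<Psi> ?t))) / \<rho>
        = 1 + - 1 * (1 / cos (\<Theta> ?t)) * sin (\<Psi> ?t)"
      using \<open>0 < \<rho>\<close> m by (simp add: field_simps)
    have "((\<lambda>t. t - \<Phi> t) has_real_derivative
        1 - (1 + - \<rho> * (1 / cos (\<Theta> ?t)) * sin (\<Psi> ?t))) (at ?t within {a..})"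
      using m by (intro DERIV_diff DERIV_ident) simp
    from DERIV_diff[OF DERIV_ident chain[OF s this]]
    show "((\<lambda>s. s - ((a + s / \<rho>) - \<Phi> (a + s / \<rho>))) has_real_derivative
        1 + - 1 * (1 / cos (\<Theta> ?t)) * sin (\<Psi> ?t)) (at s within {0..})"
      unfolding eq .
    show "((\<lambda>s. \<Theta> (a + s / \<rho>)) has_real_derivative - (- 1) * cos (\<Psi> ?t)) (at s within {0..})"
      using chain[OF s, of \<Theta> "- (- \<rho>) * cos (\<Psi> ?t)"] m \<open>0 < \<rho>\<close> by simp
    show "((\<lambda>s. \<Psi> (a + s / \<rho>)) has_real_derivative
        \<gamma> / \<rho> * sin (\<Theta> ?t) - - 1 * tan (\<Theta> ?t) * sin (\<Psi> ?t)) (at s within {0..})"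
      using chain[OF s, of \<Psi> "\<gamma> * sin (\<Theta> ?t) - - \<rho> * tan (\<Theta> ?t) * sin (\<Psi> ?t)"] m \<open>0 < \<rho>\<close>
      by (simp add: add_divide_distrib)
  qed
qed

locale normalised_orbit =
  fixes c :: real and \<phi> \<theta> \<psi> :: "real \<Rightarrow> real"
  assumes motion: "rotor_motion c (- 1) \<phi> \<theta> \<psi> {0..}"
    and start: "\<theta> 0 = 0" "\<psi> 0 = 0" and c_pos: "0 < c"
begin

lemma cos_tilt_nonzero: "0 \<le> t \<Longrightarrow> cos (\<theta> t) \<noteq> 0"
  and deriv_somersault: "0 \<le> t \<Longrightarrow>
    (\<phi> has_real_derivative 1 - sin (\<psi> t) / cos (\<theta> t)) (at t within {0..})"
  and deriv_tilt: "0 \<le> t \<Longrightarrow> (\<theta> has_real_derivative cos (\<psi> t)) (at t within {0..})"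
  and deriv_twist: "0 \<le> t \<Longrightarrow>
    (\<psi> has_real_derivative c * sin (\<theta> t) + tan (\<theta> t) * sin (\<psi> t)) (at t within {0..})"
  using motion by (simp_all add: rotor_motion_def)

lemma continuous_tilt: "continuous_on {0..t} \<theta>"
  and continuous_twist: "continuous_on {0..t} \<psi>"
proof -
  have "continuous_on {0..} \<theta>" "continuous_on {0..} \<psi>"
    using deriv_tilt deriv_twist DERIV_continuous_on[of "{0..}"] by force+
  then show "continuous_on {0..t} \<theta>" "continuous_on {0..t} \<psi>"
    by (auto elim: continuous_on_subset)
qed

text \<open>
  Conservation of energy, with the integration constant fixed by the start at zero tilt and twist.
  It expresses the twist through the tilt, up to the sign of \<open>cos \<psi>\<close>.
\<close>

lemma energy:
  assumes "0 \<le> t"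
  shows "cos (\<theta> t) * sin (\<psi> t) = c / 2 * (sin (\<theta> t))\<^sup>2"
proof -
  have "((\<lambda>t. cos (\<theta> t) * sin (\<psi> t)) has_real_derivative
      c * sin (\<theta> u) * cos (\<theta> u) * cos (\<psi> u)) (at u within {0..})" if "0 \<le> u" for u
    using cos_tilt_nonzero[OF that]
    by (auto intro!: derivative_eq_intros deriv_tilt deriv_twist that simp: tan_def field_simps)
  moreover have "((\<lambda>t. c / 2 * (sin (\<theta> t))\<^sup>2) has_real_derivative
      c * sin (\<theta> u) * cos (\<theta> u) * cos (\<psi> u)) (at u within {0..})" if "0 \<le> u" for u
    by (auto intro!: derivative_eq_intros deriv_tilt that)
  ultimately have "cos (\<theta> t) * sin (\<psi> t) - cos (\<theta> 0) * sin (\<psi> 0)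
      = c / 2 * (sin (\<theta> t))\<^sup>2 - c / 2 * (sin (\<theta> 0))\<^sup>2"
    using assms by (rule eq_if_equal_derivs_Ici)
  then show ?thesis by (simp add: start)
qed

lemma tilt_bounds:
  assumes t: "0 \<le> t"
  shows "- (pi / 2) < \<theta> t" and "\<theta> t < pi / 2"
proof -
  show "\<theta> t < pi / 2"
  proof (rule ccontr)
    assume "\<not> ?thesis"
    then obtain u where "0 \<le> u" "\<theta> u = pi / 2"
      using IVT'[of \<theta> 0 "pi / 2" t] t start continuous_tilt by auto
    then show False using cos_tilt_nonzero cos_pi_half by metis
  qed
  show "- (pi / 2) < \<theta> t"
  proof (rule ccontr)
    assume "\<not> ?thesis"
    then obtain u where "0 \<le> u" "\<theta> u = - (pi / 2)"
      using IVT2'[of \<theta> t "- (pi / 2)" 0] t start continuous_tilt by auto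
    then show False using cos_tilt_nonzero[of u] by simp
  qed
qed

lemma cos_tilt_pos: "0 \<le> t \<Longrightarrow> 0 < cos (\<theta> t)"
  using tilt_bounds by (simp add: cos_gt_zero_pi)

text \<open>
  By conservation of energy \<open>sin \<psi>\<close> never becomes negative, so the continuous twist cannot leave
  the interval on which it starts.
\<close>

lemma twist_bounds:
  assumes t: "0 \<le> t"
  shows "0 \<le> \<psi> t" and "\<psi> t \<le> pi"
proof -
  have nonneg: "0 \<le> sin (\<psi> u)" if "0 \<le> u" for u
  proof -
    have "0 \<le> cos (\<theta> u) * sin (\<psi> u)"
      unfolding energy[OF that] using c_pos by simp
    then show ?thesis using cos_tilt_pos[OF that] by (simp add: zero_le_mult_iff)
  qed
  show "\<psi> t \<le> pi"
  proof (rule ccontr)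
    assume "\<not> ?thesis"
    then obtain y where y: "pi < y" "y < 2 * pi" "y \<le> \<psi> t"
      by (metis dense min_less_iff_conj not_le less_imp_le
          pi_gt_zero mult_2 less_add_same_cancel1)
    then obtain u where "0 \<le> u" "\<psi> u = y"
      using IVT'[of \<psi> 0 y t] t start continuous_twist pi_gt_zero by force
    then show False using nonneg sin_lt_zero[OF y(1,2)] by force
  qed
  show "0 \<le> \<psi> t"
  proof (rule ccontr)
    assume "\<not> ?thesis"
    then have "max (\<psi> t) (- pi) < 0" by simp
    then obtain y where y: "- pi < y" "y < 0" "\<psi> t \<le> y"
      by (metis dense max_less_iff_conj less_imp_le)
    then obtain u where "0 \<le> u" "\<psi> u = y"
      using IVT2'[of \<psi> t y 0] t start continuous_twist by force
    then show False using nonneg sin_gt_zero[of "- y"] y by force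
  qed
qed

lemma twist_at_max_tilt:
  assumes max: "first_reaches_max \<theta> 0 b M" and M: "0 < M" "M < pi / 2"
  shows "\<psi> b = pi / 2" and "cos M = c / 2 * (sin M)\<^sup>2"
proof -
  have b: "0 \<le> b" "\<theta> b = M" and le: "\<And>t. 0 \<le> t \<Longrightarrow> \<theta> t \<le> M"
    using max by (auto simp: first_reaches_max_def)
  then have "0 < b" using start M by (cases "b = 0") auto
  have "cos (\<psi> b) = 0"
  proof (rule DERIV_local_max)
    show "DERIV \<theta> b :> cos (\<psi> b)"
      using has_real_derivative_at_Ici deriv_tilt b(1) \<open>0 < b\<close> by blast
    show "\<forall>y. \<bar>b - y\<bar> < b \<longrightarrow> \<theta> y \<le> \<theta> b"
      using le b by auto
  qed (fact \<open>0 < b\<close>)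
  then show *: "\<psi> b = pi / 2"
    using twist_bounds[OF b(1)] cos_inj_pi[of "\<psi> b" "pi / 2"] by simp
  show "cos M = c / 2 * (sin M)\<^sup>2"
    using energy[OF b(1)] by (simp add: * b(2))
qed

text \<open>
  Eliminating the twist with the energy turns \<open>sin \<theta>\<close> and its derivative \<open>cos \<theta> cos \<psi>\<close> into a
  Duffing oscillator. Its right-hand side is polynomial, so the singularity of the tilt equation
  at \<open>\<theta> = \<plusminus>\<pi>/2\<close> causes no trouble for uniqueness.
\<close>

lemma duffing:
  assumes t: "0 \<le> t"
  shows "((\<lambda>t. sin (\<theta> t)) has_real_derivative cos (\<theta> t) * cos (\<psi> t)) (at t within {0..})"
    and "((\<lambda>t. cos (\<theta> t) * cos (\<psi> t)) has_real_derivative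
      - sin (\<theta> t) - c\<^sup>2 / 2 * sin (\<theta> t) ^ 3) (at t within {0..})"
proof -
  show "((\<lambda>t. sin (\<theta> t)) has_real_derivative cos (\<theta> t) * cos (\<psi> t)) (at t within {0..})"
    by (auto intro!: derivative_eq_intros deriv_tilt t)
  have "((\<lambda>t. cos (\<theta> t) * cos (\<psi> t)) has_real_derivative
      - sin (\<theta> t) * ((cos (\<psi> t))\<^sup>2 + (sin (\<psi> t))\<^sup>2)
      - c * sin (\<theta> t) * (cos (\<theta> t) * sin (\<psi> t))) (at t within {0..})"
    by (rule derivative_eq_intros deriv_tilt deriv_twist t refl)+
      (use cos_tilt_nonzero[OF t] in
        \<open>simp add: tan_def field_simps power2_eq_square del: sin_cos_squared_add3\<close>)
  also have "- sin (\<theta> t) * ((cos (\<psi> t))\<^sup>2 + (sin (\<psi> t))\<^sup>2)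
      - c * sin (\<theta> t) * (cos (\<theta> t) * sin (\<psi> t)) = - sin (\<theta> t) - c\<^sup>2 / 2 * sin (\<theta> t) ^ 3"
    by (simp add: energy[OF t] power2_eq_square power3_eq_cube flip: power2_eq_square)
  finally show "((\<lambda>t. cos (\<theta> t) * cos (\<psi> t)) has_real_derivative
      - sin (\<theta> t) - c\<^sup>2 / 2 * sin (\<theta> t) ^ 3) (at t within {0..})" .
qed

lemma deriv_somersault_by_tilt:
  assumes t: "0 \<le> t"
  shows "(\<phi> has_real_derivative 1 - c / 2 * (tan (\<theta> t))\<^sup>2) (at t within {0..})"
proof -
  have "sin (\<psi> t) / cos (\<theta> t) = c / 2 * (tan (\<theta> t))\<^sup>2"
    using energy[OF t] cos_tilt_nonzero[OF t] by (simp add: tan_def field_simps power2_eq_square)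
  with deriv_somersault[OF t] show ?thesis by simp
qed

end

section \<open>The maximal tilt determines the somersault deficit\<close>

text \<open>
  Uniqueness for the Duffing oscillator: the squared distance of two solutions in the phase plane
  grows at most exponentially, because the cubic term is Lipschitz on \<open>[-1, 1]\<close>.
\<close>

lemma normalised_orbit_tilt_unique:
  assumes "normalised_orbit c \<phi> \<theta> \<psi>" "normalised_orbit c \<phi>' \<theta>' \<psi>'" and t: "0 \<le> t"
  shows "\<theta> t = \<theta>' t"
proof -
  interpret A: normalised_orbit c \<phi> \<theta> \<psi> by fact
  interpret B: normalised_orbit c \<phi>' \<theta>' \<psi>' by fact
  let ?z = "\<lambda>t. sin (\<theta> t)" and ?w = "\<lambda>t. sin (\<theta>' t)"
  define p where "p t = sin (\<theta> t) - sin (\<theta>' t)" for t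
  define q where "q t = cos (\<theta> t) * cos (\<psi> t) - cos (\<theta>' t) * cos (\<psi>' t)" for t
  define m where "m t = (?z t)\<^sup>2 + ?z t * ?w t + (?w t)\<^sup>2" for t
  have p: "(p has_real_derivative q u) (at u within {0..})" if "0 \<le> u" for u
    unfolding p_def q_def using A.duffing(1)[OF that] B.duffing(1)[OF that] by (rule DERIV_diff)
  have q: "(q has_real_derivative - p u - c\<^sup>2 / 2 * (p u * m u)) (at u within {0..})"
    if "0 \<le> u" for u
  proof -
    have "- p u - c\<^sup>2 / 2 * (p u * m u) =
      (- ?z u - c\<^sup>2 / 2 * ?z u ^ 3) - (- ?w u - c\<^sup>2 / 2 * ?w u ^ 3)"
      by (simp add: p_def m_def algebra_simps power2_eq_square power3_eq_cube)
    then show ?thesis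
      unfolding q_def using DERIV_diff[OF A.duffing(2)[OF that] B.duffing(2)[OF that]] by simp
  qed
  \<comment> \<open>In the derivative of \<open>p\<^sup>2 + q\<^sup>2\<close> the linear terms \<open>2pq\<close> and \<open>-2qp\<close> cancel. What the cubic
    term leaves is at most \<open>3c\<^sup>2\<bar>pq\<bar>\<close>, since \<open>\<bar>m\<bar> \<le> 3\<close>.\<close>
  have "(p t)\<^sup>2 + (q t)\<^sup>2 = 0"
  proof (rule gronwall_zero[where a = 0 and C = "3 * c\<^sup>2 / 2"
        and f = "\<lambda>t. (p t)\<^sup>2 + (q t)\<^sup>2" and d = "\<lambda>t. - c\<^sup>2 * (p t * q t * m t)"])
    show "((\<lambda>t. (p t)\<^sup>2 + (q t)\<^sup>2) has_real_derivative - c\<^sup>2 * (p u * q u * m u))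
        (at u within {0..})" if "0 \<le> u" for u
      by (auto intro!: derivative_eq_intros p q that simp: algebra_simps)
    show "- c\<^sup>2 * (p u * q u * m u) \<le> 3 * c\<^sup>2 / 2 * ((p u)\<^sup>2 + (q u)\<^sup>2)"
      if "0 \<le> u" for u
    proof -
      have sq: "(?z u)\<^sup>2 \<le> 1" "(?w u)\<^sup>2 \<le> 1"
        by (simp_all add: abs_square_le_1)
      have "\<bar>?z u * ?w u\<bar> \<le> 1"
        using mult_mono[of "\<bar>?z u\<bar>" 1 "\<bar>?w u\<bar>" 1] by (simp add: abs_mult)
      then have m: "\<bar>m u\<bar> \<le> 3"
        using sq zero_le_power2[of "?z u"] zero_le_power2[of "?w u"]
        unfolding m_def by linarith
      have pq: "2 * \<bar>p u * q u\<bar> \<le> (p u)\<^sup>2 + (q u)\<^sup>2"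
        using sum_squares_bound[of "\<bar>p u\<bar>" "\<bar>q u\<bar>"] by (simp add: abs_mult)
      have "- (p u * q u * m u) \<le> \<bar>p u * q u\<bar> * \<bar>m u\<bar>"
        by (simp flip: abs_mult)
      also have "\<dots> \<le> \<bar>p u * q u\<bar> * 3"
        using m by (intro mult_left_mono) simp_all
      also have "\<dots> \<le> 3 / 2 * ((p u)\<^sup>2 + (q u)\<^sup>2)"
        using pq by simp
      finally have "c\<^sup>2 * - (p u * q u * m u) \<le> c\<^sup>2 * (3 / 2 * ((p u)\<^sup>2 + (q u)\<^sup>2))"
        by (rule mult_left_mono) simp
      then show ?thesis by (simp add: algebra_simps)
    qed
  qed (simp_all add: p_def q_def A.start B.start t)
  then have "sin (\<theta> t) = sin (\<theta>' t)"
    by (simp add: p_def)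
  then show ?thesis
    using A.tilt_bounds[OF t] B.tilt_bounds[OF t] sin_inj_pi[of "\<theta> t" "\<theta>' t"] by simp
qed

text \<open>
  The energy relation at maximal tilt fixes the parameter, hence the whole tilt curve and the
  moment at which the maximum is attained; the somersault rate is a function of the tilt.
\<close>

lemma normalised_orbit_lag_unique:
  assumes "normalised_orbit c \<phi> \<theta> \<psi>" "normalised_orbit c' \<phi>' \<theta>' \<psi>'"
    and max: "first_reaches_max \<theta> 0 b M" "first_reaches_max \<theta>' 0 b' M"
    and M: "0 < M" "M < pi / 2"
  shows "b - (\<phi> b - \<phi> 0) = b' - (\<phi>' b' - \<phi>' 0)"
proof -
  interpret A: normalised_orbit c \<phi> \<theta> \<psi> by fact
  interpret B: normalised_orbit c' \<phi>' \<theta>' \<psi>' by fact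
  have "c / 2 * (sin M)\<^sup>2 = c' / 2 * (sin M)\<^sup>2"
    using A.twist_at_max_tilt(2)[OF max(1) M, symmetric] B.twist_at_max_tilt(2)[OF max(2) M]
    by (rule trans)
  moreover have "sin M \<noteq> 0"
    using M sin_gt_zero[of M] by simp
  ultimately have c: "c' = c"
    by (metis mult_right_cancel power_not_zero divide_cancel_right zero_neq_numeral)
  have tilt: "\<theta> t = \<theta>' t" if "0 \<le> t" for t
    using normalised_orbit_tilt_unique[OF assms(1) assms(2)[unfolded c] that] .
  have "b' = b"
    using max tilt unfolding first_reaches_max_def by (metis less_irrefl not_less_iff_gr_or_eq)
  moreover have "\<phi> b - \<phi> 0 = \<phi>' b - \<phi>' 0"
  proof (rule eq_if_equal_derivs_Ici)
    show "(\<phi> has_real_derivative 1 - c / 2 * (tan (\<theta> t))\<^sup>2) (at t within {0..})"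
      if "0 \<le> t" for t by (rule A.deriv_somersault_by_tilt[OF that])
    show "(\<phi>' has_real_derivative 1 - c / 2 * (tan (\<theta> t))\<^sup>2) (at t within {0..})"
      if "0 \<le> t" for t using B.deriv_somersault_by_tilt[OF that] by (simp add: tilt[OF that] c)
    show "0 \<le> b" using max(1) by (simp add: first_reaches_max_def)
  qed
  ultimately show ?thesis by simp
qed

text \<open>
  The amount by which somersault falls behind time while the rotor tilts the body up to \<open>M\<close>. It is
  the same in original and normalised time, and by the preceding lemma the description is unique.
\<close>

definition tilting_lag :: "real \<Rightarrow> real" where
  "tilting_lag M = (THE v. \<exists>c \<phi> \<theta> \<psi> b. normalised_orbit c \<phi> \<theta> \<psi> \<and>
     first_reaches_max \<theta> 0 b M \<and> v = b - (\<phi> b - \<phi> 0))"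

lemma normalised_orbit_lag:
  assumes "normalised_orbit c \<phi> \<theta> \<psi>" "first_reaches_max \<theta> 0 b M" "0 < M" "M < pi / 2"
  shows "b - (\<phi> b - \<phi> 0) = tilting_lag M"
  unfolding tilting_lag_def
  using assms by (intro the_equality[symmetric]) (blast, metis normalised_orbit_lag_unique)

section \<open>The stages of a dive\<close>

lemma rotor_off_advance:
  assumes motion: "rotor_motion \<gamma> 0 \<phi> \<theta> \<psi> {a..b}" and "a \<le> b"
    and tilt: "\<And>t. t \<in> {a..b} \<Longrightarrow> \<theta> t = \<alpha>"
  shows "\<phi> b - \<phi> a = b - a" and "\<psi> b - \<psi> a = \<gamma> * sin \<alpha> * (b - a)"
proof -
  have linear: "f b - f a = k * (b - a)"
    if f: "\<And>t. t \<in> {a..b} \<Longrightarrow> (f has_real_derivative k) (at t within {a..b})" for f k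
  proof -
    have "((\<lambda>t. f t - k * t) has_real_derivative 0) (at t within {a..b})" if "t \<in> {a..b}" for t
      using DERIV_diff[OF f[OF that]
          DERIV_cmult[OF DERIV_ident, of k t "{a..b}"]] by simp
    then obtain d where "\<And>t. t \<in> {a..b} \<Longrightarrow> f t - k * t = d"
      using has_field_derivative_zero_constant[of "{a..b}" "\<lambda>t. f t - k * t"] by auto
    from this[of a] this[of b] show ?thesis
      using \<open>a \<le> b\<close> by (simp add: algebra_simps)
  qed
  show "\<phi> b - \<phi> a = b - a"
    using linear[of \<phi> 1] motion by (simp add: rotor_motion_def)
  show "\<psi> b - \<psi> a = \<gamma> * sin \<alpha> * (b - a)"
    using linear[of \<psi> "\<gamma> * sin \<alpha>"] motion tilt by (simp add: rotor_motion_def)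
qed

lemma rotor_on_advance:
  assumes motion: "rotor_motion \<gamma> (- \<rho>) \<Phi> \<Theta> \<Psi> {a..}" and "0 < \<gamma>" "0 < \<rho>"
    and start: "\<Theta> a = 0" "\<Psi> a = 0"
    and max: "first_reaches_max \<Theta> a b M" and M: "0 < M" "M < pi / 2"
  shows "\<Psi> b = pi / 2" and "(b - a) - (\<Phi> b - \<Phi> a) = tilting_lag M"
proof -
  let ?\<phi> = "\<lambda>s. s - ((a + s / \<rho>) - \<Phi> (a + s / \<rho>))"
  let ?\<theta> = "\<lambda>s. \<Theta> (a + s / \<rho>)" and ?\<psi> = "\<lambda>s. \<Psi> (a + s / \<rho>)"
  let ?b = "\<rho> * (b - a)"
  have orbit: "normalised_orbit (\<gamma> / \<rho>) ?\<phi> ?\<theta> ?\<psi>"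
    using rotor_motion_rescale[OF motion \<open>0 < \<rho>\<close>] start \<open>0 < \<gamma>\<close> \<open>0 < \<rho>\<close>
    by unfold_locales simp_all
  have b: "a + ?b / \<rho> = b"
    using \<open>0 < \<rho>\<close> by simp
  have max': "first_reaches_max ?\<theta> 0 ?b M"
    unfolding first_reaches_max_def
  proof (intro conjI allI impI)
    show "0 \<le> ?b" "?\<theta> ?b = M"
      using max \<open>0 < \<rho>\<close> by (auto simp: first_reaches_max_def)
    show "?\<theta> s \<le> M" if "0 \<le> s" for s
      using max \<open>0 < \<rho>\<close> that by (simp add: first_reaches_max_def)
    show "?\<theta> s < M" if "0 \<le> s \<and> s < ?b" for s
    proof -
      have "a + s / \<rho> < b"
        using that \<open>0 < \<rho>\<close> by (simp add: field_simps)
      then show ?thesis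
        using max \<open>0 < \<rho>\<close> that by (simp add: first_reaches_max_def)
    qed
  qed
  show "\<Psi> b = pi / 2"
    using normalised_orbit.twist_at_max_tilt(1)[OF orbit max' M] b by simp
  show "(b - a) - (\<Phi> b - \<Phi> a) = tilting_lag M"
    using normalised_orbit_lag[OF orbit max' M] \<open>0 < \<rho>\<close> by simp
qed

text \<open>
  Neighbouring stages share their end point, so stage 2 inherits zero tilt and twist from stage 1,
  and its maximal tilt and duration are those of the orbit on the half-line that extends it.
\<close>

lemma dive_advances:
  assumes dive: "dive \<gamma> \<rho> n M \<tau>\<^sub>1 \<tau>\<^sub>2 \<tau>\<^sub>3 \<phi> \<theta> \<psi>"
    and "0 < \<gamma>" "0 < \<rho>" and M: "0 < M" "M < pi / 2"
  defines "\<Delta> \<equiv> advance \<tau>\<^sub>1 \<tau>\<^sub>2 \<tau>\<^sub>3"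
  shows "0 \<le> \<tau>\<^sub>1"
    and "\<Delta> \<phi> 1 = \<tau>\<^sub>1" "\<Delta> \<psi> 1 = 0"
    and "\<tau>\<^sub>2 - \<Delta> \<phi> 2 = tilting_lag M" "\<Delta> \<psi> 2 = pi / 2"
    and "\<Delta> \<phi> 3 = \<tau>\<^sub>3" "\<Delta> \<psi> 3 = \<gamma> * sin M * \<tau>\<^sub>3"
proof -
  define e where "e = stage_end \<tau>\<^sub>1 \<tau>\<^sub>2 \<tau>\<^sub>3"
  have e: "e 0 = 0" "e 1 = \<tau>\<^sub>1" "e 2 = \<tau>\<^sub>1 + \<tau>\<^sub>2" "e 3 = \<tau>\<^sub>1 + \<tau>\<^sub>2 + \<tau>\<^sub>3"
    by (simp_all add: e_def stage_end_def numeral_eq_Suc)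
  have S: "stage \<tau>\<^sub>1 \<tau>\<^sub>2 \<tau>\<^sub>3 1 = {0..\<tau>\<^sub>1}" "stage \<tau>\<^sub>1 \<tau>\<^sub>2 \<tau>\<^sub>3 2 = {\<tau>\<^sub>1..\<tau>\<^sub>1 + \<tau>\<^sub>2}"
    "stage \<tau>\<^sub>1 \<tau>\<^sub>2 \<tau>\<^sub>3 3 = {\<tau>\<^sub>1 + \<tau>\<^sub>2..\<tau>\<^sub>1 + \<tau>\<^sub>2 + \<tau>\<^sub>3}"
    by (simp_all add: stage_def stage_end_def numeral_eq_Suc)
  have \<Delta>: "\<Delta> f 1 = f \<tau>\<^sub>1 - f 0" "\<Delta> f 2 = f (\<tau>\<^sub>1 + \<tau>\<^sub>2) - f \<tau>\<^sub>1"
    "\<Delta> f 3 = f (\<tau>\<^sub>1 + \<tau>\<^sub>2 + \<tau>\<^sub>3) - f (\<tau>\<^sub>1 + \<tau>\<^sub>2)" for f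
    by (simp_all add: \<Delta>_def advance_def stage_end_def numeral_eq_Suc add.assoc)
  note D = dive[unfolded dive_def Let_def, folded e_def, unfolded S e]
  have nonneg: "0 \<le> \<tau>\<^sub>1" "0 \<le> \<tau>\<^sub>2" "0 \<le> \<tau>\<^sub>3"
    using D by blast+
  then show "0 \<le> \<tau>\<^sub>1" by simp
  have one: "rotor_motion \<gamma> 0 \<phi> \<theta> \<psi> {0..\<tau>\<^sub>1}" "\<And>t. t \<in> {0..\<tau>\<^sub>1} \<Longrightarrow> \<theta> t = 0 \<and> \<psi> t = 0"
    using D by blast+
  have three: "rotor_motion \<gamma> 0 \<phi> \<theta> \<psi> {\<tau>\<^sub>1 + \<tau>\<^sub>2..\<tau>\<^sub>1 + \<tau>\<^sub>2 + \<tau>\<^sub>3}"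
    "\<And>t. t \<in> {\<tau>\<^sub>1 + \<tau>\<^sub>2..\<tau>\<^sub>1 + \<tau>\<^sub>2 + \<tau>\<^sub>3} \<Longrightarrow> \<theta> t = M"
    using D by blast+
  obtain \<Phi> \<Theta> \<Psi> where two: "rotor_motion \<gamma> (- \<rho>) \<Phi> \<Theta> \<Psi> {\<tau>\<^sub>1..}"
    "\<And>t. t \<in> {\<tau>\<^sub>1..\<tau>\<^sub>1 + \<tau>\<^sub>2} \<Longrightarrow> \<Phi> t = \<phi> t \<and> \<Theta> t = \<theta> t \<and> \<Psi> t = \<psi> t"
    "first_reaches_max \<Theta> \<tau>\<^sub>1 (\<tau>\<^sub>1 + \<tau>\<^sub>2) M"
    using D by blast
  show "\<Delta> \<phi> 1 = \<tau>\<^sub>1"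
    using rotor_off_advance(1)[OF one(1) nonneg(1), of 0] one(2) by (simp add: \<Delta>[unfolded One_nat_def])
  show "\<Delta> \<psi> 1 = 0"
    using one(2) nonneg by (simp add: \<Delta>[unfolded One_nat_def])
  show "\<Delta> \<phi> 3 = \<tau>\<^sub>3" "\<Delta> \<psi> 3 = \<gamma> * sin M * \<tau>\<^sub>3"
    using rotor_off_advance[OF three(1) _ three(2)] nonneg by (simp_all add: \<Delta>)
  have start: "\<Theta> \<tau>\<^sub>1 = 0" "\<Psi> \<tau>\<^sub>1 = 0"
    using two(2) one(2) nonneg by simp_all
  note adv = rotor_on_advance[OF two(1) \<open>0 < \<gamma>\<close> \<open>0 < \<rho>\<close> start two(3) M]
  show "\<tau>\<^sub>2 - \<Delta> \<phi> 2 = tilting_lag M" "\<Delta> \<psi> 2 = pi / 2"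
    using adv two(2) one(2) nonneg by (simp_all add: \<Delta>)
qed

section \<open>Total time and duration of the pure somersault\<close>

theorem theorem6:
  "\<exists>F :: real \<Rightarrow> real.
     \<forall>(I\<^sub>1::real) (I\<^sub>2::real) (I\<^sub>3::real) (l::real) (\<gamma>::real) (\<rho>::real) (\<theta>\<^sub>m\<^sub>a\<^sub>x::real)
      (T\<^sub>1::real) (T\<^sub>2::real) (T\<^sub>3::real) (T\<^sub>t\<^sub>o\<^sub>t::real) (m::real) (n::real)
      (\<phi>::real \<Rightarrow> real) (\<theta>::real \<Rightarrow> real) (\<psi>::real \<Rightarrow> real) (\<phi>\<^sub>2::real).
       I\<^sub>1 > 0 \<longrightarrow> I\<^sub>3 > 0 \<longrightarrow> I\<^sub>1 = I\<^sub>2 \<longrightarrow> \<gamma> = I\<^sub>1 / I\<^sub>3 - 1 \<longrightarrow> \<gamma> > 0 \<longrightarrow>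
       l > 0 \<longrightarrow> \<rho> > 0 \<longrightarrow> 0 < \<theta>\<^sub>m\<^sub>a\<^sub>x \<longrightarrow> \<theta>\<^sub>m\<^sub>a\<^sub>x < pi / 2 \<longrightarrow>
       n \<ge> 1 / 2 \<longrightarrow> 2 * n \<in> \<int> \<longrightarrow>
       dive \<gamma> \<rho> n \<theta>\<^sub>m\<^sub>a\<^sub>x (l / I\<^sub>1 * T\<^sub>1) (l / I\<^sub>1 * T\<^sub>2) (l / I\<^sub>1 * T\<^sub>3) \<phi> \<theta> \<psi> \<longrightarrow>
       somersaults_twists m n (l / I\<^sub>1 * T\<^sub>1) (l / I\<^sub>1 * T\<^sub>2) (l / I\<^sub>1 * T\<^sub>3) \<phi> \<psi> \<longrightarrow>
       T\<^sub>t\<^sub>o\<^sub>t = 2 * T\<^sub>2 + T\<^sub>3 + 2 * T\<^sub>1 \<longrightarrow>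
       \<phi>\<^sub>2 = advance (l / I\<^sub>1 * T\<^sub>1) (l / I\<^sub>1 * T\<^sub>2) (l / I\<^sub>1 * T\<^sub>3) \<phi> 2 \<longrightarrow>
         l / I\<^sub>1 * T\<^sub>t\<^sub>o\<^sub>t - 2 * m * pi = 2 * (l / I\<^sub>1) * T\<^sub>2 - 2 * \<phi>\<^sub>2
       \<and> 2 * (l / I\<^sub>1) * T\<^sub>2 - 2 * \<phi>\<^sub>2 = F (sin \<theta>\<^sub>m\<^sub>a\<^sub>x)
       \<and> 2 * (l / I\<^sub>1) * T\<^sub>1
           = 2 * pi * m - 2 * \<phi>\<^sub>2 - 2 * pi * (n - 1 / 2) / (\<gamma> * sin \<theta>\<^sub>m\<^sub>a\<^sub>x)
       \<and> 2 * pi * m - 2 * \<phi>\<^sub>2 - 2 * pi * (n - 1 / 2) / (\<gamma> * sin \<theta>\<^sub>m\<^sub>a\<^sub>x) \<ge> 0"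
  \<comment> \<open>Since \<open>\<theta>\<^sub>m\<^sub>a\<^sub>x\<close> is acute, \<open>arcsin\<close> recovers it from its sine.\<close>
proof (rule exI[of _ "\<lambda>s. 2 * tilting_lag (arcsin s)"], intro allI impI)
  fix I\<^sub>1 I\<^sub>2 I\<^sub>3 l \<gamma> \<rho> M T\<^sub>1 T\<^sub>2 T\<^sub>3 T m n :: real and \<phi> \<theta> \<psi> :: "real \<Rightarrow> real" and \<phi>\<^sub>2 :: real
  let ?k = "l / I\<^sub>1"
  let ?\<Delta> = "advance (?k * T\<^sub>1) (?k * T\<^sub>2) (?k * T\<^sub>3)"
  assume "0 < \<gamma>" "0 < \<rho>" and M: "0 < M" "M < pi / 2"
    and dive: "dive \<gamma> \<rho> n M (?k * T\<^sub>1) (?k * T\<^sub>2) (?k * T\<^sub>3) \<phi> \<theta> \<psi>"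
    and count: "somersaults_twists m n (?k * T\<^sub>1) (?k * T\<^sub>2) (?k * T\<^sub>3) \<phi> \<psi>"
    and T: "T = 2 * T\<^sub>2 + T\<^sub>3 + 2 * T\<^sub>1" and \<phi>\<^sub>2: "\<phi>\<^sub>2 = ?\<Delta> \<phi> 2"
  note adv = dive_advances[OF dive \<open>0 < \<gamma>\<close> \<open>0 < \<rho>\<close> M, folded \<phi>\<^sub>2]
  have "2 * ?\<Delta> \<phi> 1 + 2 * ?\<Delta> \<phi> 2 + ?\<Delta> \<phi> 3 = 2 * m * pi"
    "2 * ?\<Delta> \<psi> 1 + 2 * ?\<Delta> \<psi> 2 + ?\<Delta> \<psi> 3 = 2 * n * pi"
    using count by (simp_all add: somersaults_twists_def Let_def)
  then have somersaults: "2 * (?k * T\<^sub>1) + 2 * \<phi>\<^sub>2 + ?k * T\<^sub>3 = 2 * m * pi"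
    and twists: "pi + \<gamma> * sin M * (?k * T\<^sub>3) = 2 * n * pi"
    unfolding adv \<phi>\<^sub>2[symmetric] by simp_all
  have "0 < \<gamma> * sin M"
    using \<open>0 < \<gamma>\<close> M by (simp add: sin_gt_zero)
  then have T\<^sub>3: "?k * T\<^sub>3 = 2 * pi * (n - 1 / 2) / (\<gamma> * sin M)"
    using twists by (simp add: nonzero_eq_divide_eq[OF less_imp_neq[symmetric]] algebra_simps
        del: mult_eq_0_iff)
  have T\<^sub>1: "2 * ?k * T\<^sub>1 = 2 * pi * m - 2 * \<phi>\<^sub>2 - 2 * pi * (n - 1 / 2) / (\<gamma> * sin M)"
    using somersaults unfolding T\<^sub>3[symmetric] by (simp add: algebra_simps)
  have "?k * T = 2 * (?k * T\<^sub>2) + ?k * T\<^sub>3 + 2 * (?k * T\<^sub>1)"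
    unfolding T by (simp only: distrib_left mult.left_commute)
  then have "?k * T - 2 * m * pi = 2 * ?k * T\<^sub>2 - 2 * \<phi>\<^sub>2"
    using somersaults by simp
  moreover have "2 * ?k * T\<^sub>2 - 2 * \<phi>\<^sub>2 = 2 * tilting_lag (arcsin (sin M))"
    using adv(4) M by (simp add: arcsin_sin)
  moreover have "0 \<le> 2 * ?k * T\<^sub>1"
    using adv(1) by simp
  ultimately show "?k * T - 2 * m * pi = 2 * ?k * T\<^sub>2 - 2 * \<phi>\<^sub>2
      \<and> 2 * ?k * T\<^sub>2 - 2 * \<phi>\<^sub>2 = 2 * tilting_lag (arcsin (sin M))
      \<and> 2 * ?k * T\<^sub>1 = 2 * pi * m - 2 * \<phi>\<^sub>2 - 2 * pi * (n - 1 / 2) / (\<gamma> * sin M)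
      \<and> 2 * pi * m - 2 * \<phi>\<^sub>2 - 2 * pi * (n - 1 / 2) / (\<gamma> * sin M) \<ge> 0"
    using T\<^sub>1 by simp
qed

end
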